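(* For every nonzero integer $m$ and every integer $n \ge 1$, \[ H_{n} \;=\; \frac{1}{m}\,\sum_{k=1}^{n} \frac{(-1)^{k+1}}{k}\,\binom{mk}{k}\binom{n + (m-1)k}{n - k}, \] where $H_n = \sum_{i=1}^{n} \frac{1}{i}$ is the $n$-th harmonic number.
   Context: Binomial coefficients are the generalized ones: for $a \in \mathbb{Z}$ and $b \in \mathbb{Z}_{\ge 0}$, $\binom{a}{b} = a(a-1)\cdots(a-b+1)/b!$ (so $\binom{a}{0}=1$, and $a$ may be negative). *)

theory Defs
  imports "HOL-Analysis.Harmonic_Numbers"
begin

end

theory Submission
  imports Defs "HOL-Computational_Algebra.Polynomial"
begin

text \<open>
  The difference of the sums (without the factor \<open>1 / m\<close>) for \<open>Suc n\<close> and \<open>n\<close> is again a sum of this kind,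
  by Pascal's rule in the last factor. Absorption and trinomial revision turn its summand into
  \<open>(-1)\<^sup>k\<^sup>+\<^sup>1 m / (n + 1)\<close> times \<open>n + 1 choose k\<close> times a polynomial in \<open>k\<close> of degree at most \<open>n\<close>,
  whose value at \<open>0\<close> is \<open>1\<close>. The alternating sum over all \<open>k \<ge> 0\<close> is a finite difference of order
  \<open>n + 1\<close> and vanishes, so the sum over \<open>k \<ge> 1\<close> equals minus its term at \<open>0\<close>, that is
  \<open>m / (n + 1)\<close>.
\<close>

text \<open>Pascal's rule and an index shift trade one order of the finite difference for one
  differencing of \<open>f\<close>, which drives the induction on the order.\<close>

lemma alternating_binomial_sum_Suc:
  fixes f :: "nat \<Rightarrow> 'a::comm_ring_1"
  shows "(\<Sum>k\<le>Suc n. (-1) ^ k * of_nat (Suc n choose k) * f k) =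
    (\<Sum>k\<le>n. (-1) ^ k * of_nat (n choose k) * (f k - f (Suc k)))"
proof -
  have "(\<Sum>k\<le>Suc n. (-1) ^ k * of_nat (Suc n choose k) * f k) =
      f 0 + (\<Sum>k\<le>n. (-1) ^ Suc k * of_nat (n choose Suc k) * f (Suc k))
      - (\<Sum>k\<le>n. (-1) ^ k * of_nat (n choose k) * f (Suc k))"
    unfolding sum.atMost_Suc_shift
    by (simp add: algebra_simps sum.distrib sum_subtractf sum_negf)
  also have "f 0 + (\<Sum>k\<le>n. (-1) ^ Suc k * of_nat (n choose Suc k) * f (Suc k)) =
      (\<Sum>k\<le>Suc n. (-1) ^ k * of_nat (n choose k) * f k)"
    unfolding sum.atMost_Suc_shift by simp
  also have "\<dots> = (\<Sum>k\<le>n. (-1) ^ k * of_nat (n choose k) * f k)"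
    by (simp add: binomial_eq_0)
  finally show ?thesis
    by (simp add: right_diff_distrib sum_subtractf)
qed

text \<open>Each differencing lowers the degree or gives 0, so \<open>n\<close> of them annihilate
  \<open>p\<close>.\<close>

lemma alternating_binomial_sum_poly_eq_0:
  fixes p :: "'a::idom poly"
  assumes "degree p < n"
  shows "(\<Sum>k\<le>n. (-1) ^ k * of_nat (n choose k) * poly p (of_nat k)) = 0"
  using assms
proof (induction n arbitrary: p)
  case 0
  then show ?case by simp
next
  case (Suc n)
  define q where "q = p - pcompose p [:1, 1:]"
  have "degree q \<le> degree p"
    unfolding q_def by (rule degree_diff_le) (simp_all add: degree_pcompose)
  \<comment> \<open>The substitution x + 1 is monic, so the leading coefficients cancel.\<close>
  moreover have "coeff q (degree p) = 0"
    using lead_coeff_comp[of "[:1, 1:]" p] by (simp add: q_def degree_pcompose)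
  \<comment> \<open>The case \<open>q = 0\<close> covers constant \<open>p\<close>, whose degree
    cannot drop.\<close>
  ultimately have "q = 0 \<or> degree q < degree p"
    by (rule eq_zero_or_degree_less)
  then have "(\<Sum>k\<le>n. (-1) ^ k * of_nat (n choose k) * poly q (of_nat k)) = 0"
    using Suc.IH[of q] Suc.prems by fastforce
  then show ?case
    unfolding alternating_binomial_sum_Suc by (simp add: q_def poly_pcompose)
qed

lemma alternating_binomial_gbinomial_sum_eq_0:
  fixes b c :: "'a::field_char_0"
  assumes "j < n"
  shows "(\<Sum>k\<le>n. (-1) ^ k * of_nat (n choose k) * (b + c * of_nat k gchoose j)) = 0"
proof -
  \<comment> \<open>The falling factorial of b + c x as a product of \<open>j\<close> factors of
    degree at most 1.\<close>
  define p where "p = smult (inverse (fact j)) (\<Prod>i<j. [:b - of_nat i, c:])"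
  have "degree p \<le> degree (\<Prod>i<j. [:b - of_nat i, c:])"
    unfolding p_def by (rule degree_smult_le)
  also have "\<dots> \<le> (\<Sum>i<j. degree [:b - of_nat i, c:])"
    by (rule degree_prod_sum_le[unfolded o_def]) simp
  also have "\<dots> \<le> (\<Sum>i<j. 1)"
    by (intro sum_mono) simp
  finally have "degree p < n"
    using assms by simp
  moreover have "poly p x = (b + c * x gchoose j)" for x
    by (simp add: p_def poly_prod gbinomial_prod_rev atLeast0LessThan field_simps)
  ultimately show ?thesis
    using alternating_binomial_sum_poly_eq_0[of p n] by simp
qed

lemma gbinomial_sum_increment:
  fixes m :: "'a::field_char_0"
  shows "(\<Sum>k=1..Suc n. (-1) ^ (k + 1) / of_nat k * (m * of_nat k gchoose k)
      * (of_nat n + (m - 1) * of_nat k gchoose (Suc n - k))) = m / of_nat (Suc n)"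
proof -
  \<comment> \<open>Unlike the original summand with its division by \<open>k\<close>,
    \<open>t\<close> has the right value at 0 too, so the full alternating sum applies.\<close>
  define t where "t k = (-1) ^ k * of_nat (Suc n choose k) * (of_nat n + (m - 1) * of_nat k gchoose n)"
    for k
  have summand: "(-1) ^ (k + 1) / of_nat k * (m * of_nat k gchoose k)
      * (of_nat n + (m - 1) * of_nat k gchoose (Suc n - k)) = - (m / of_nat (Suc n)) * t k"
    if "k \<in> {1..Suc n}" for k
  proof -
    from that obtain l where k: "k = Suc l" and l: "l \<le> n"
      by (cases k) auto
    define a where "a = of_nat n + (m - 1) * of_nat k"
    \<comment> \<open>Passing to the lower index \<open>n - l\<close> makes the revised upper
      argument \<open>m * of_nat k - 1\<close>, as left by absorption in
      \<open>m * of_nat k gchoose k\<close>.\<close>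
    have "(a gchoose n) * of_nat (n choose l) = (a gchoose n) * (of_nat n gchoose (n - l))"
      using l by (simp add: binomial_gbinomial binomial_symmetric[of l n])
    also have "\<dots> = (a gchoose (n - l)) * (a - of_nat (n - l) gchoose l)"
      using gbinomial_trinomial_revision[of "n - l" n a] l by simp
    also have "a - of_nat (n - l) = m * of_nat k - 1"
      using l by (simp add: a_def k of_nat_diff algebra_simps)
    finally have revision: "(a gchoose n) * of_nat (n choose l) =
        (a gchoose (n - l)) * (m * of_nat k - 1 gchoose l)" .
    \<comment> \<open>The factor \<open>k\<close> gained here cancels the 1/k of the
      summand.\<close>
    have "of_nat (n choose l) = (of_nat k / of_nat (Suc n) * of_nat (Suc n choose k) :: 'a)"
      using Suc_times_binomial_eq[of n l, THEN arg_cong[where f = "of_nat :: nat \<Rightarrow> 'a"]]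
      unfolding k of_nat_mult by (simp add: field_simps del: of_nat_Suc binomial_Suc_Suc)
    moreover have "(m * of_nat k gchoose k) = m * (m * of_nat k - 1 gchoose l)"
      using gbinomial_absorption'[of k "m * of_nat k"] by (simp add: k del: of_nat_Suc)
    then have "(m * of_nat k gchoose k) * (a gchoose (n - l)) =
        m * ((a gchoose n) * of_nat (n choose l))"
      unfolding revision by simp
    ultimately have "(m * of_nat k gchoose k) * (a gchoose (n - l)) =
        m * of_nat k / of_nat (Suc n) * of_nat (Suc n choose k) * (a gchoose n)"
      by simp
    then have "(-1) ^ (k + 1) / of_nat k * ((m * of_nat k gchoose k) * (a gchoose (n - l))) =
        - (m / of_nat (Suc n)) * ((-1) ^ k * of_nat (Suc n choose k) * (a gchoose n))"
      by (simp add: k del: of_nat_Suc binomial_Suc_Suc)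
    then show ?thesis
      by (simp add: t_def a_def k mult.assoc)
  qed
  have "(\<Sum>k\<le>Suc n. t k) = 0"
    unfolding t_def by (rule alternating_binomial_gbinomial_sum_eq_0) simp
  moreover have "t 0 = 1"
    by (simp add: t_def flip: binomial_gbinomial)
  ultimately have "(\<Sum>k=1..Suc n. t k) = -1"
    using sum.atLeast_Suc_atMost[of 0 "Suc n" t]
    by (simp add: atMost_atLeast0 eq_neg_iff_add_eq_0 add.commute)
  then show ?thesis
    by (simp only: sum.cong[OF refl summand] flip: sum_distrib_left) simp
qed

text \<open>The increments telescope to \<open>m\<close> times the harmonic sum.\<close>

lemma gbinomial_sum_eq_harm:
  fixes m :: "'a::real_normed_field"
  shows "(\<Sum>k=1..n. (-1) ^ (k + 1) / of_nat k * (m * of_nat k gchoose k)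
      * (of_nat n + (m - 1) * of_nat k gchoose (n - k))) = m * harm n"
proof (induction n)
  case 0
  then show ?case by (simp add: harm_expand)
next
  case (Suc n)
  define f where "f k = (-1) ^ (k + 1) / of_nat k * (m * of_nat k gchoose k)" for k
  \<comment> \<open>At \<open>k = Suc n\<close> the lower index is 0 and Pascal's rule does not
    apply; that term goes unchanged into the second sum, which therefore runs to
    \<open>Suc n\<close>.\<close>
  have pascal: "(of_nat (Suc n) + (m - 1) * of_nat k gchoose (Suc n - k)) =
      (of_nat n + (m - 1) * of_nat k gchoose (n - k)) +
      (of_nat n + (m - 1) * of_nat k gchoose (Suc n - k))" if "k \<le> n" for k
    using gbinomial_Suc_Suc[of "of_nat n + (m - 1) * of_nat k" "n - k"] that
    by (simp add: Suc_diff_le add_ac)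
  have "(\<Sum>k=1..Suc n. f k * (of_nat (Suc n) + (m - 1) * of_nat k gchoose (Suc n - k))) =
      (\<Sum>k=1..n. f k * (of_nat n + (m - 1) * of_nat k gchoose (n - k))) +
      (\<Sum>k=1..Suc n. f k * (of_nat n + (m - 1) * of_nat k gchoose (Suc n - k)))"
    by (simp add: pascal distrib_left sum.distrib del: of_nat_Suc)
  also have "\<dots> = m * harm n + m / of_nat (Suc n)"
    using Suc.IH gbinomial_sum_increment[of m n] by (simp only: f_def)
  also have "\<dots> = m * harm (Suc n)"
    by (simp add: harm_Suc field_simps del: of_nat_Suc)
  finally show ?case
    by (simp only: f_def)
qed

theorem theorem1p1:
  fixes m :: int and n :: nat
  assumes "m \<noteq> 0" and "n \<ge> 1"
  shows "(harm n :: real) =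
    1 / of_int m * (\<Sum>k=1..n. (-1) ^ (k + 1) / of_nat k
      * (of_int (m * int k) gchoose k)
      * (of_int (int n + (m - 1) * int k) gchoose (n - k)))"
  using gbinomial_sum_eq_harm[of "of_int m :: real" n] assms(1) by simp

end
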